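(* Let $a,b,\tau$ be positive integers with $a<b$ and $1\le\tau<b$, and for each integer $n\ge 0$ let $G=\mathcal{T}_\tau(n;a,b)$. Then: 1. If $\tau>b-a$, then $G\in\mathscr{L}$ for all $n\ge b+1$. 2. If $\tau=b-a$, let $t=n\bmod (b+1)$, $0\le t\le b$. Then, for all $n\ge 0$: (a) $G\in\mathscr{P}$ if $t=0$; (b) $G\in\mathscr{L}$ if $1\le t\le\tau$; (c) $G\in\mathscr{N}$ if $\tau+1\le t\le b$. 3. If $\tau<b-a$, then $G\in\mathscr{R}$ for all $n\ge\left\lfloor\frac{b-a}{b-a-\tau}\right\rfloor(a+\tau+1)$.
   Context: Games are two-player games (players Left and Right) under normal play: a player unable to move on their turn loses. Truncated Support (TS): for positive integers $a<b$ and an integer truncation level $\tau$ with $1\le\tau<b$, and a heap size $n\ge0$, $\mathcal{T}_\tau(n;a,b)$ is the game played on one heap of $n$ pebbles in which Left, on her turn, may remove any number $i\in\{1,\dots,a\}$ of pebbles with $i\le n$, and Right, on his turn, may remove any number $j\in\{\tau+1,\dots,b\}$ with $j\le n$. Outcome classes: $G\in\mathscr{L}$ if Left wins no matter who starts; $G\in\mathscr{R}$ if Right wins no matter who starts; $G\in\mathscr{N}$ if the player who starts (next player) wins; $G\in\mathscr{P}$ if the player who does not start (previous player) wins. *)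

theory Defs
  imports Complex_Main
begin

datatype player = Left | Right

fun opponent :: "player \<Rightarrow> player" where
  "opponent Left = Right"
| "opponent Right = Left"

(* A game is a move relation together with a starting position; M X p is the set of
   positions to which player X may move from p. *)
type_synonym 'p game = "(player \<Rightarrow> 'p \<Rightarrow> 'p set) \<times> 'p"

(* wins M X Y p: player X has a winning strategy from position p when Y is to move.
   Normal play: rule reply holds vacuously when the opponent to move has no move,
   and X, when to move, can only win by making a move. *)
inductive wins :: "(player \<Rightarrow> 'p \<Rightarrow> 'p set) \<Rightarrow> player \<Rightarrow> player \<Rightarrow> 'p \<Rightarrow> bool"
  for M :: "player \<Rightarrow> 'p \<Rightarrow> 'p set" where
  move: "q \<in> M X p \<Longrightarrow> wins M X (opponent X) q \<Longrightarrow> wins M X X p"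
| reply: "(\<And>q. q \<in> M (opponent X) p \<Longrightarrow> wins M X X q) \<Longrightarrow> wins M X (opponent X) p"

definition outcome_L :: "'p game set" where
  "outcome_L = {(M, p). wins M Left Left p \<and> wins M Left Right p}"

definition outcome_R :: "'p game set" where
  "outcome_R = {(M, p). wins M Right Left p \<and> wins M Right Right p}"

definition outcome_N :: "'p game set" where
  "outcome_N = {(M, p). wins M Left Left p \<and> wins M Right Right p}"

definition outcome_P :: "'p game set" where
  "outcome_P = {(M, p). wins M Right Left p \<and> wins M Left Right p}"

fun ts_moves :: "nat \<Rightarrow> nat \<Rightarrow> nat \<Rightarrow> player \<Rightarrow> nat \<Rightarrow> nat set" where
  "ts_moves \<tau> a b Left n = {n - i | i. i \<in> {1..a} \<and> i \<le> n}"
| "ts_moves \<tau> a b Right n = {n - j | j. j \<in> {\<tau>+1..b} \<and> j \<le> n}"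

definition truncated_support :: "nat \<Rightarrow> nat \<Rightarrow> nat \<Rightarrow> nat \<Rightarrow> nat game" where
  "truncated_support \<tau> n a b = (ts_moves \<tau> a b, n)"

end

theory Submission imports Defs begin

text \<open>
  The three regimes are governed by how far the advantage of a player spreads. From every
  heap of at most \<open>\<tau>\<close> pebbles Right cannot move, so Left moving first wins on
  \<open>1, \<dots>, a + \<tau>\<close>, while Right moving first wins on \<open>\<tau> + 1, \<dots>, b\<close> by emptying the heap. The
  comparison of \<open>a + \<tau>\<close> with \<open>b\<close> decides what happens next.

  If \<open>a + \<tau> > b\<close>, every nonempty heap is won by Left moving first: from heaps of at least
  \<open>b + 1\<close> pebbles Right cannot empty the heap and must hand over a nonempty one
  (\<open>Left_wins_large_heaps\<close>).

  If \<open>a + \<tau> = b\<close>, the two effects balance: from \<open>(k + 1)(b + 1)\<close> Left can move only to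
  sizes at which Right wins moving first, Right cannot pass from one multiple of \<open>b + 1\<close> to
  another, and the pattern on \<open>0, \<dots>, b\<close> repeats with period \<open>b + 1\<close>
  (\<open>balanced_block_start\<close>, \<open>balanced_block\<close>).

  If \<open>a + \<tau> < b\<close>, put \<open>m = a + \<tau> + 1\<close> and \<open>c = b - a - \<tau> > 0\<close>. When Right moving first wins on
  an interval, Left moving first loses on the interval obtained by raising the lower end by
  \<open>a\<close> and the upper end by \<open>1\<close>; when Left moving first loses on an interval, Right moving first
  wins on the one obtained by raising the lower end by \<open>\<tau> + 1\<close> and the upper end by \<open>b\<close>. A
  round of both raises the lower end by \<open>m\<close> and the upper end by \<open>b + 1 = m + c\<close>. Starting
  from the empty heap, Left moving first therefore loses on all intervals
  \<open>[k m, k m + k c]\<close>, which grow by \<open>c\<close> in each round (\<open>Right_wins_replying_on_interval\<close>). The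
  resulting intervals on which Right wins moving first start \<open>m\<close> apart, and they leave no
  gap once \<open>(k + 1) c > \<tau>\<close>; the smallest such \<open>k + 1\<close> is
  \<open>\<lfloor>\<tau> / c\<rfloor> + 1 = \<lfloor>(b - a) / c\<rfloor>\<close>, which is the bound of the theorem.
\<close>

section \<open>Moves as intervals of heap sizes\<close>

lemma Left_wins_by_moving:
  assumes "wins (ts_moves \<tau> a b) Left Right m" and "m < n" and "n \<le> m + a"
  shows "wins (ts_moves \<tau> a b) Left Left n"
proof (rule wins.move)
  show "m \<in> ts_moves \<tau> a b Left n"
    using assms(2,3) by (auto intro!: exI[of _ "n - m"])
  show "wins (ts_moves \<tau> a b) Left (opponent Left) m"
    using assms(1) by simp
qed

lemma Right_wins_by_moving:
  assumes "wins (ts_moves \<tau> a b) Right Left m" and "m + \<tau> < n" and "n \<le> m + b"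
  shows "wins (ts_moves \<tau> a b) Right Right n"
proof (rule wins.move)
  show "m \<in> ts_moves \<tau> a b Right n"
    using assms(2,3) by (auto intro!: exI[of _ "n - m"])
  show "wins (ts_moves \<tau> a b) Right (opponent Right) m"
    using assms(1) by simp
qed

lemma Left_wins_by_replying:
  assumes "\<And>m. m + \<tau> < n \<Longrightarrow> n \<le> m + b \<Longrightarrow> wins (ts_moves \<tau> a b) Left Left m"
  shows "wins (ts_moves \<tau> a b) Left Right n"
proof -
  have "wins (ts_moves \<tau> a b) Left (opponent Left) n"
    by (rule wins.reply) (auto intro!: assms)
  then show ?thesis by simp
qed

lemma Right_wins_by_replying:
  assumes "\<And>m. m < n \<Longrightarrow> n \<le> m + a \<Longrightarrow> wins (ts_moves \<tau> a b) Right Right m"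
  shows "wins (ts_moves \<tau> a b) Right Left n"
proof -
  have "wins (ts_moves \<tau> a b) Right (opponent Right) n"
    by (rule wins.reply) (auto intro!: assms)
  then show ?thesis by simp
qed

lemma Left_wins_replying_on_small_heap:
  assumes "n \<le> \<tau>"
  shows "wins (ts_moves \<tau> a b) Left Right n"
  using assms by (intro Left_wins_by_replying) simp

section \<open>Truncation above the balance\<close>

text \<open>
  Left moves a heap of at most \<open>a + \<tau>\<close> pebbles into the region where Right is stuck. From a
  larger heap a single pebble suffices, because at least \<open>a + \<tau> > b\<close> pebbles remain and Right
  cannot empty the heap.
\<close>

lemma Left_wins_moving_on_nonempty_heap:
  assumes "0 < a" and "b < a + \<tau>" and "0 < n"
  shows "wins (ts_moves \<tau> a b) Left Left n"
  using assms(3)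
proof (induction n rule: less_induct)
  case (less n)
  show ?case
  proof (cases "n \<le> a + \<tau>")
    case True
    have "wins (ts_moves \<tau> a b) Left Right (n - a)"
      using True by (intro Left_wins_replying_on_small_heap) linarith
    then show ?thesis
      by (rule Left_wins_by_moving) (use less.prems \<open>0 < a\<close> in linarith)+
  next
    case False
    have "wins (ts_moves \<tau> a b) Left Right (n - 1)"
    proof (rule Left_wins_by_replying)
      fix m assume "m + \<tau> < n - 1" and "n - 1 \<le> m + b"
      then have "0 < m" and "m < n"
        using False \<open>b < a + \<tau>\<close> by linarith+
      then show "wins (ts_moves \<tau> a b) Left Left m"
        by (intro less.IH)
    qed
    then show ?thesis
      by (rule Left_wins_by_moving) (use less.prems \<open>0 < a\<close> in linarith)+
  qed
qed

lemma Left_wins_large_heaps: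
  assumes "0 < a" and "b < a + \<tau>" and "b < n"
  shows "truncated_support \<tau> n a b \<in> outcome_L"
proof -
  have "wins (ts_moves \<tau> a b) Left Left m" if "n \<le> m + b" for m
    using that assms by (intro Left_wins_moving_on_nonempty_heap) linarith+
  then have "wins (ts_moves \<tau> a b) Left Left n" "wins (ts_moves \<tau> a b) Left Right n"
    by (auto intro: Left_wins_by_replying)
  then show ?thesis
    by (simp add: truncated_support_def outcome_L_def)
qed

section \<open>Balanced truncation\<close>

text \<open>
  The sizes from \<open>s\<close> to \<open>s + \<tau>\<close> are a target for Left: removing \<open>a\<close> pebbles, or \<open>t\<close> if
  \<open>t < a\<close>, lands there as long as \<open>t \<le> a + \<tau>\<close>.
\<close>

lemma Left_wins_moving_in_block:
  assumes "0 < a" and "b = a + \<tau>"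
    and "\<And>t. t \<le> \<tau> \<Longrightarrow> wins (ts_moves \<tau> a b) Left Right (s + t)"
    and "0 < t" and "t \<le> b"
  shows "wins (ts_moves \<tau> a b) Left Left (s + t)"
proof (rule Left_wins_by_moving)
  show "wins (ts_moves \<tau> a b) Left Right (s + (t - a))"
    using assms by (intro assms(3)) linarith
  show "s + (t - a) < s + t" and "s + t \<le> s + (t - a) + a"
    using assms by linarith+
qed

lemma balanced_block_start:
  assumes "0 < a" and "b = a + \<tau>"
  shows "wins (ts_moves \<tau> a b) Right Left (k * (b + 1)) \<and>
    (\<forall>t\<le>\<tau>. wins (ts_moves \<tau> a b) Left Right (k * (b + 1) + t))"
proof (induction k)
  case 0
  show ?case
    by (auto intro: Right_wins_by_replying Left_wins_replying_on_small_heap)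
next
  case (Suc k)
  define s where "s = k * (b + 1)"
  have next_s: "Suc k * (b + 1) = s + b + 1"
    by (simp add: s_def)
  from Suc.IH have P: "wins (ts_moves \<tau> a b) Right Left s"
    and L: "\<And>t. t \<le> \<tau> \<Longrightarrow> wins (ts_moves \<tau> a b) Left Right (s + t)"
    by (simp_all add: s_def)
  have "wins (ts_moves \<tau> a b) Right Left (s + b + 1)"
  proof (rule Right_wins_by_replying)
    fix m assume "m < s + b + 1" and "s + b + 1 \<le> m + a"
    \<comment> \<open>Left cannot get past the last \<open>a\<close> sizes of the block, and from these Right reaches \<open>s\<close>.\<close>
    then show "wins (ts_moves \<tau> a b) Right Right m"
      using assms(2) by (intro Right_wins_by_moving[OF P]) linarith+
  qed
  moreover have "wins (ts_moves \<tau> a b) Left Right (s + b + 1 + t)" if "t \<le> \<tau>" for t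
  proof (rule Left_wins_by_replying)
    fix m assume *: "m + \<tau> < s + b + 1 + t" "s + b + 1 + t \<le> m + b"
    \<comment> \<open>Right can reach neither \<open>s\<close> nor \<open>s + b + 1\<close>: that would take more than \<open>b\<close> or at most
        \<open>\<tau>\<close> pebbles.\<close>
    have "wins (ts_moves \<tau> a b) Left Left (s + (m - s))"
      using * that by (intro Left_wins_moving_in_block[OF assms L]) linarith+
    then show "wins (ts_moves \<tau> a b) Left Left m"
      using * by simp
  qed
  ultimately show ?case
    unfolding next_s by blast
qed

lemma balanced_block:
  assumes "0 < a" and "b = a + \<tau>" and "t = n mod (b + 1)"
  shows "t = 0 \<Longrightarrow> truncated_support \<tau> n a b \<in> outcome_P"
    and "1 \<le> t \<Longrightarrow> t \<le> \<tau> \<Longrightarrow> truncated_support \<tau> n a b \<in> outcome_L"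
    and "\<tau> + 1 \<le> t \<Longrightarrow> t \<le> b \<Longrightarrow> truncated_support \<tau> n a b \<in> outcome_N"
proof -
  define s where "s = n div (b + 1) * (b + 1)"
  have n: "n = s + t"
    by (simp only: s_def assms(3) div_mult_mod_eq)
  have P: "wins (ts_moves \<tau> a b) Right Left s"
    and L: "\<And>t. t \<le> \<tau> \<Longrightarrow> wins (ts_moves \<tau> a b) Left Right (s + t)"
    using balanced_block_start[OF assms(1,2)] by (simp_all only: s_def)
  note LL = Left_wins_moving_in_block[OF assms(1,2) L]
  show "truncated_support \<tau> n a b \<in> outcome_P" if "t = 0"
    using that P L[of 0] by (simp add: truncated_support_def outcome_P_def n)
  show "truncated_support \<tau> n a b \<in> outcome_L" if "1 \<le> t" "t \<le> \<tau>"
    using that L LL assms(2) by (simp add: truncated_support_def outcome_L_def n)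
  show "truncated_support \<tau> n a b \<in> outcome_N" if "\<tau> + 1 \<le> t" "t \<le> b"
    using that LL Right_wins_by_moving[OF P, of n]
    by (simp add: truncated_support_def outcome_N_def n)
qed

section \<open>Truncation below the balance\<close>

text \<open>
  Each round of a move by Left and an answer by Right stretches the interval by \<open>c\<close>, because
  the two extreme choices of Right differ by \<open>b - (\<tau> + 1) = (a - 1) + c\<close>, which exceeds by
  \<open>c\<close> the difference \<open>a - 1\<close> that Left controls.
\<close>

lemma Right_wins_replying_on_interval:
  assumes "b = a + \<tau> + c"
    and "k * (a + \<tau> + 1) \<le> n" and "n \<le> k * (a + \<tau> + 1) + k * c"
  shows "wins (ts_moves \<tau> a b) Right Left n"
  using assms(2,3)
proof (induction k arbitrary: n)
  case 0
  then show ?case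
    by (intro Right_wins_by_replying) simp
next
  case (Suc k)
  define lo hi where "lo = k * (a + \<tau> + 1)" and "hi = lo + k * c"
  have bounds: "lo + a + \<tau> + 1 \<le> n" "n \<le> hi + b + 1"
    using Suc.prems by (simp_all add: lo_def hi_def assms(1))
  show ?case
  proof (rule Right_wins_by_replying)
    fix m assume *: "m < n" "n \<le> m + a"
    \<comment> \<open>Right removes as many pebbles as possible, but stops at \<open>lo\<close>.\<close>
    let ?q = "max lo (m - b)"
    have "lo \<le> hi"
      by (simp add: hi_def)
    then have "lo \<le> ?q" "?q \<le> hi"
      using * bounds by linarith+
    then have "wins (ts_moves \<tau> a b) Right Left ?q"
      unfolding hi_def lo_def by (rule Suc.IH)
    moreover have "?q + \<tau> < m" "m \<le> ?q + b"
      using * bounds assms(1) by linarith+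
    ultimately show "wins (ts_moves \<tau> a b) Right Right m"
      by (rule Right_wins_by_moving)
  qed
qed

text \<open>
  The intervals on which Right wins moving first start at \<open>k m + \<tau> + 1\<close>. The last of them that
  starts at or below \<open>n\<close> contains \<open>n\<close>, because for \<open>k \<ge> K\<close> it reaches up to the start of the
  next one.
\<close>

lemma Right_wins_moving_eventually:
  assumes "b = a + \<tau> + c" and "\<tau> < (K + 1) * c" and "K * (a + \<tau> + 1) + \<tau> + 1 \<le> n"
  shows "wins (ts_moves \<tau> a b) Right Right n"
proof -
  define m where "m = a + \<tau> + 1"
  define k where "k = (n - (\<tau> + 1)) div m"
  define r where "r = (n - (\<tau> + 1)) mod m"
  have "0 < m"
    by (simp add: m_def)
  then have "r < m"
    by (simp add: r_def)
  have "n - (\<tau> + 1) = k * m + r"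
    by (simp add: k_def r_def)
  then have n: "n = k * m + r + \<tau> + 1"
    using assms(3) by linarith
  have "K * m \<le> n - (\<tau> + 1)"
    using assms(3) by (simp add: m_def)
  then have "K \<le> k"
    using \<open>0 < m\<close> by (simp add: k_def less_eq_div_iff_mult_less_eq)
  then have "(K + 1) * c \<le> (k + 1) * c"
    by (intro mult_right_mono) simp_all
  with assms(2) have "\<tau> < (k + 1) * c"
    by (rule less_le_trans)
  then have "\<tau> < k * c + c"
    by simp
  let ?q = "max (k * m) (n - b)"
  have "n - b \<le> k * m + k * c"
    using n \<open>r < m\<close> \<open>\<tau> < k * c + c\<close> assms(1) m_def by linarith
  then have "k * m \<le> ?q" "?q \<le> k * m + k * c"
    by simp_all
  then have "wins (ts_moves \<tau> a b) Right Left ?q"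
    unfolding m_def by (rule Right_wins_replying_on_interval[OF assms(1)])
  moreover have "0 < c"
    using assms(2) by (cases c) simp_all
  then have "?q + \<tau> < n" "n \<le> ?q + b"
    using n assms(1) by linarith+
  ultimately show ?thesis
    by (rule Right_wins_by_moving)
qed

lemma Right_wins_large_heaps:
  assumes "b = a + \<tau> + c" and "\<tau> < (K + 1) * c" and "(K + 1) * (a + \<tau> + 1) \<le> n"
  shows "truncated_support \<tau> n a b \<in> outcome_R"
proof -
  have "wins (ts_moves \<tau> a b) Right Right m" if "n \<le> m + a" for m
    using that assms(3) by (intro Right_wins_moving_eventually[OF assms(1,2)]) simp
  then have "wins (ts_moves \<tau> a b) Right Right n" "wins (ts_moves \<tau> a b) Right Left n"
    by (auto intro: Right_wins_by_replying)
  then show ?thesis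
    by (simp add: truncated_support_def outcome_R_def)
qed

text \<open>The number of rounds in \<open>Right_wins_large_heaps\<close> in the form \<open>\<lfloor>(b - a) / c\<rfloor>\<close>.\<close>

lemma floor_rounds:
  fixes a b c \<tau> :: nat
  assumes "b = a + \<tau> + c" and "0 < c"
  shows "\<lfloor>(real b - real a) / (real b - real a - real \<tau>)\<rfloor> = int (\<tau> div c + 1)"
proof -
  have "(real b - real a) / (real b - real a - real \<tau>) = real (\<tau> + c) / real c"
    by (simp add: assms(1))
  then have "\<lfloor>(real b - real a) / (real b - real a - real \<tau>)\<rfloor> = int ((\<tau> + c) div c)"
    by (simp only: floor_divide_of_nat_eq)
  then show ?thesis
    using assms(2) by simp
qed

theorem theorem3:
  fixes a b \<tau> :: nat
  assumes "0 < a" and "a < b" and "1 \<le> \<tau>" and "\<tau> < b"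
  shows "(\<tau> > b - a \<longrightarrow> (\<forall>n. n \<ge> b + 1 \<longrightarrow> truncated_support \<tau> n a b \<in> outcome_L)) \<and>
    (\<tau> = b - a \<longrightarrow> (\<forall>n t. t = n mod (b + 1) \<longrightarrow>
        (t = 0 \<longrightarrow> truncated_support \<tau> n a b \<in> outcome_P) \<and>
        (1 \<le> t \<and> t \<le> \<tau> \<longrightarrow> truncated_support \<tau> n a b \<in> outcome_L) \<and>
        (\<tau> + 1 \<le> t \<and> t \<le> b \<longrightarrow> truncated_support \<tau> n a b \<in> outcome_N))) \<and>
    (\<tau> < b - a \<longrightarrow> (\<forall>n.
        int n \<ge> \<lfloor>(real b - real a) / (real b - real a - real \<tau>)\<rfloor> * (int a + int \<tau> + 1) \<longrightarrow>
        truncated_support \<tau> n a b \<in> outcome_R))"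
proof (intro conjI impI allI)
  fix n assume "\<tau> > b - a" and "n \<ge> b + 1"
  then show "truncated_support \<tau> n a b \<in> outcome_L"
    using assms by (intro Left_wins_large_heaps) linarith+
next
  fix n t assume "\<tau> = b - a" and t: "t = n mod (b + 1)"
  then have b: "b = a + \<tau>"
    using assms(2) by linarith
  note block = balanced_block[OF assms(1) b t]
  show "truncated_support \<tau> n a b \<in> outcome_P" if "t = 0"
    using that by (rule block)
  show "truncated_support \<tau> n a b \<in> outcome_L" if "1 \<le> t \<and> t \<le> \<tau>"
    using that by (intro block) simp_all
  show "truncated_support \<tau> n a b \<in> outcome_N" if "\<tau> + 1 \<le> t \<and> t \<le> b"
    using that by (intro block) simp_all
next
  fix n
  assume "\<tau> < b - a"
    and n: "int n \<ge> \<lfloor>(real b - real a) / (real b - real a - real \<tau>)\<rfloor> * (int a + int \<tau> + 1)"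
  then obtain c where b: "b = a + \<tau> + c" and c: "0 < c"
    by (metis add.assoc add_diff_inverse_nat assms(2) less_imp_add_positive not_less_iff_gr_or_eq)
  have "int ((\<tau> div c + 1) * (a + \<tau> + 1)) \<le> int n"
    using n unfolding floor_rounds[OF b c] by (simp add: algebra_simps)
  then have "(\<tau> div c + 1) * (a + \<tau> + 1) \<le> n"
    by (simp only: of_nat_le_iff)
  moreover have "\<tau> < (\<tau> div c + 1) * c"
    using dividend_less_div_times[OF c, of \<tau>] by simp
  ultimately show "truncated_support \<tau> n a b \<in> outcome_R"
    by (intro Right_wins_large_heaps[OF b])
qed

end
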